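(* Let $V$ be a two-Higgs-doublet potential with parameters $M^\mu$ and $\Lambda^{\mu\nu}$ satisfying the positivity constraint, written in the frame of its prototypical model, $\Lambda^{\mu\nu}=\mathrm{diag}(\Lambda_0,-\Lambda_1,-\Lambda_2,-\Lambda_3)$ with $\Lambda_0>0$ and $\Lambda_0>\Lambda_3>\Lambda_2>\Lambda_1$. Let neutral stationary points be counted as points $r^\mu$ of the orbit space. Then: (1) if $M^\mu$ lies outside $LC^-$, at least one neutral stationary point exists; (2) if $M^\mu$ lies inside $LC^+$, at least two neutral stationary points exist; (3) if $M^\mu$, in addition, lies inside one of the two caustic cones $C_1$, $C_2$, then two additional neutral stationary points exist, besides those counted in (1) or (2) (so at least three in case (1) and at least four in case (2)); (4) if $M^\mu$ lies inside both caustic cones, then four additional neutral stationary points exist, besides those counted in (1) or (2) (so at least five in case (1) and at least six in case (2)).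
   Context: Two Higgs doublets $\phi_1,\phi_2\in\mathbb{C}^2$ are given, and the general potential is $V=-M_\mu r^\mu+\frac12\Lambda_{\mu\nu}r^\mu r^\nu$ (sum over repeated indices $0,\dots,3$), with a real four-vector $M^\mu$ and a real symmetric tensor $\Lambda^{\mu\nu}$, where $r^0=\phi_1^\dagger\phi_1+\phi_2^\dagger\phi_2$, $r^1=2\,\mathrm{Re}(\phi_1^\dagger\phi_2)$, $r^2=2\,\mathrm{Im}(\phi_1^\dagger\phi_2)$, $r^3=\phi_1^\dagger\phi_1-\phi_2^\dagger\phi_2$. Indices are raised and lowered with $g=\mathrm{diag}(1,-1,-1,-1)$. The set of all $r^\mu$ (the orbit space) is the closed solid future light-cone $LC^+=\{r: r^0\ge 0,\ r^\mu r_\mu\ge 0\}$; the past light-cone is $LC^-=-LC^+$. Points $r^\mu$ correspond one-to-one to orbits of the electroweak group $U(2)$ acting simultaneously on $\phi_1,\phi_2$. The positivity constraint, $\Lambda_{\mu\nu}r^\mu r^\nu>0$ for every nonzero $r\in LC^+$, implies that $\Lambda^{\mu\nu}$ can be brought by a proper orthochronous Lorentz transformation (induced by an $SL(2,\mathbb{C})$ transformation of the doublets) to the diagonal form $\mathrm{diag}(\Lambda_0,-\Lambda_1,-\Lambda_2,-\Lambda_3)$ with $\Lambda_0>0$, $\Lambda_0>\Lambda_i$; the model in this frame is the prototypical model. A neutral stationary point is a point $r^\mu$ with $r\ne0$, $r^\mu r_\mu=0$ (i.e. $\phi_1,\phi_2$ proportional and not both zero) corresponding to field configurations at which the gradient of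 $V$ with respect to the eight real fields vanishes. Caustic cones: for $i=1,2$, $C_i\subset\mathbb{R}^4$ is the region swept, as $v^2$ ranges over $(0,\infty)$, by the sets $$\mathcal{M}^{(i)}_v=\Big\{\big(\tfrac12v^2\Lambda_0-\zeta,\ (\tfrac12v^2\Lambda_1-\zeta)n_1,\ (\tfrac12v^2\Lambda_2-\zeta)n_2,\ (\tfrac12v^2\Lambda_3-\zeta)n_3\big):\ \tfrac12v^2\Lambda_i\le\zeta\le\tfrac12v^2\Lambda_{i+1},\ n_1^2+n_2^2+n_3^2=1\Big\}.$$ "Lies inside" $LC^+$ or $C_i$ means belongs to the topological interior of that set; "outside $LC^-$" means not in the closed cone $LC^-$. *)

theory Defs
  imports "HOL-Analysis.Analysis"
begin

text \<open>
  Four-vectors have type \<^typ>\<open>real^4\<close>.  The elements of the index type \<^typ>\<open>4\<close> are the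
  residues modulo 4, so \<open>$ 0\<close>, \<open>$ 1\<close>, \<open>$ 2\<close>, \<open>$ 3\<close> are its four distinct components
  (and \<open>$ 4\<close> is the same as \<open>$ 0\<close>).
\<close>

definition fourvec :: "real \<Rightarrow> real \<Rightarrow> real \<Rightarrow> real \<Rightarrow> real^4" where
  "fourvec a b c d =
     (\<chi> \<mu>. if \<mu> = 0 then a else if \<mu> = 1 then b else if \<mu> = 2 then c else d)"

definition metric :: "real^4^4" where
  "metric = (\<chi> \<mu> \<nu>. if \<mu> = \<nu> then (if \<mu> = 0 then 1 else - 1) else 0)"

definition lower_vec :: "real^4 \<Rightarrow> real^4" where
  "lower_vec x = metric *v x"

definition lower_tensor :: "real^4^4 \<Rightarrow> real^4^4" where
  "lower_tensor L = metric ** L ** metric"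

definition minkowski :: "real^4 \<Rightarrow> real^4 \<Rightarrow> real" where
  "minkowski x y = (\<Sum>\<mu>\<in>UNIV. x $ \<mu> * lower_vec y $ \<mu>)"

definition LC_plus :: "(real^4) set" where
  "LC_plus = {r. r $ 0 \<ge> 0 \<and> minkowski r r \<ge> 0}"

definition LC_minus :: "(real^4) set" where
  "LC_minus = uminus ` LC_plus"

definition herm :: "complex^2 \<Rightarrow> complex^2 \<Rightarrow> complex" where
  "herm x y = (\<Sum>a\<in>UNIV. cnj (x $ a) * y $ a)"

type_synonym doublets = "(complex^2) \<times> (complex^2)"

definition orbit_vec :: "doublets \<Rightarrow> real^4" where
  "orbit_vec \<phi> =
     fourvec (Re (herm (fst \<phi>) (fst \<phi>)) + Re (herm (snd \<phi>) (snd \<phi>)))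
             (2 * Re (herm (fst \<phi>) (snd \<phi>)))
             (2 * Im (herm (fst \<phi>) (snd \<phi>)))
             (Re (herm (fst \<phi>) (fst \<phi>)) - Re (herm (snd \<phi>) (snd \<phi>)))"

text \<open>The parameters \<open>M\<close> and \<open>L\<close> always carry upper indices.\<close>

definition quartic_form :: "real^4^4 \<Rightarrow> real^4 \<Rightarrow> real" where
  "quartic_form L r = (\<Sum>\<mu>\<in>UNIV. \<Sum>\<nu>\<in>UNIV. lower_tensor L $ \<mu> $ \<nu> * r $ \<mu> * r $ \<nu>)"

definition potential :: "real^4 \<Rightarrow> real^4^4 \<Rightarrow> doublets \<Rightarrow> real" where
  "potential M L \<phi> =
     - (\<Sum>\<mu>\<in>UNIV. lower_vec M $ \<mu> * orbit_vec \<phi> $ \<mu>)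
     + 1/2 * quartic_form L (orbit_vec \<phi>)"

definition positivity_constraint :: "real^4^4 \<Rightarrow> bool" where
  "positivity_constraint L \<longleftrightarrow> (\<forall>r\<in>LC_plus. r \<noteq> 0 \<longrightarrow> quartic_form L r > 0)"

text \<open>
  The gradient is taken with respect to the real inner product on \<^typ>\<open>doublets\<close>, whose
  orthonormal coordinates are the real and imaginary parts of the four complex components.
  Since \<^term>\<open>potential M L\<close> is constant on the orbits of the electroweak group, and these
  are the fibres of \<^const>\<open>orbit_vec\<close>, one stationary configuration over \<open>r\<close> makes all
  configurations over \<open>r\<close> stationary.
\<close>

definition neutral_stationary_points :: "real^4 \<Rightarrow> real^4^4 \<Rightarrow> (real^4) set" where
  "neutral_stationary_points M L =
     {r. r \<noteq> 0 \<and> minkowski r r = 0 \<and>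
         (\<exists>\<phi>. orbit_vec \<phi> = r \<and> GDERIV (potential M L) \<phi> :> 0)}"

text \<open>The vector \<open>\<Lambda>\<close> lists the parameters \<open>\<Lambda>\<^sub>0, \<dots>, \<Lambda>\<^sub>3\<close> of the prototypical model.\<close>

definition prototype_tensor :: "real^4 \<Rightarrow> real^4^4" where
  "prototype_tensor \<Lambda> =
     (\<chi> \<mu> \<nu>. if \<mu> = \<nu> then (if \<mu> = 0 then \<Lambda> $ 0 else - \<Lambda> $ \<mu>) else 0)"

definition caustic_slice :: "real^4 \<Rightarrow> 4 \<Rightarrow> real \<Rightarrow> (real^4) set" where
  "caustic_slice \<Lambda> i v =
     {fourvec (1/2 * v\<^sup>2 * \<Lambda> $ 0 - \<zeta>)
              ((1/2 * v\<^sup>2 * \<Lambda> $ 1 - \<zeta>) * n1)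
              ((1/2 * v\<^sup>2 * \<Lambda> $ 2 - \<zeta>) * n2)
              ((1/2 * v\<^sup>2 * \<Lambda> $ 3 - \<zeta>) * n3) | \<zeta> n1 n2 n3.
        1/2 * v\<^sup>2 * \<Lambda> $ i \<le> \<zeta> \<and> \<zeta> \<le> 1/2 * v\<^sup>2 * \<Lambda> $ (i + 1) \<and>
        n1\<^sup>2 + n2\<^sup>2 + n3\<^sup>2 = 1}"

text \<open>Meaningful for \<open>i = 1\<close> and \<open>i = 2\<close> only.\<close>

definition caustic_cone :: "real^4 \<Rightarrow> 4 \<Rightarrow> (real^4) set" where
  "caustic_cone \<Lambda> i = (\<Union>v\<in>{0<..}. caustic_slice \<Lambda> i v)"

text \<open>No finiteness of \<open>A\<close> is implied.\<close>

definition has_at_least :: "nat \<Rightarrow> 'a set \<Rightarrow> bool" where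
  "has_at_least n A \<longleftrightarrow> (\<exists>S\<subseteq>A. finite S \<and> card S = n)"

end

theory Submission
  imports Defs "HOL-Real_Asymp.Real_Asymp"
begin

text \<open>
  Since \<open>r\<^sup>\<mu> r\<^sub>\<mu> \<ge> 0\<close> on the orbit space, a null \<open>r\<close> is stationary as soon as the gradient of \<open>V\<close> with
  respect to \<open>r\<close> is proportional to \<open>r\<^sub>\<mu>\<close>, that is \<open>(\<Lambda>\<^sub>\<mu> - \<zeta>) r\<^sup>\<mu> = M\<^sup>\<mu>\<close> for some \<open>\<zeta>\<close>.  Writing
  \<open>r = T (1, n)\<close> with \<open>T > 0\<close> and a unit vector \<open>n\<close>, and eliminating \<open>\<zeta>\<close>, this becomes
  \<open>(M\<^sub>0 - (\<Lambda>\<^sub>0 - \<Lambda>\<^sub>i) T) n\<^sub>i = M\<^sub>i\<close>, so that \<open>T\<close> is a zero of the secular function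
  \<open>h T = (\<Sum>i. (M\<^sub>i / (M\<^sub>0 - (\<Lambda>\<^sub>0 - \<Lambda>\<^sub>i) T))\<^sup>2) - 1\<close>.

  For \<open>M\<^sub>0 > 0\<close> the function \<open>h\<close> has three poles \<open>p\<^sub>1 < p\<^sub>2 < p\<^sub>3\<close> on the positive axis, tends to \<open>-1\<close>
  at infinity, is negative at \<open>0\<close> if \<open>M\<close> lies inside the future cone, and is negative somewhere between
  \<open>p\<^sub>i\<close> and \<open>p\<^sub>i\<^sub>+\<^sub>1\<close> if \<open>M\<close> lies inside the \<open>i\<close>-th caustic cone.  As \<open>h\<close> tends to \<open>+\<infinity>\<close> at the poles, two
  consecutive points where \<open>h\<close> is negative enclose two zeros, and the first such point has a zero
  before it.  If \<open>M\<^sub>i = 0\<close>, the pole \<open>p\<^sub>i\<close> is removable; either \<open>h p\<^sub>i \<ge> 0\<close> and the zeros persist, or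
  \<open>h p\<^sub>i < 0\<close> and \<open>T = p\<^sub>i\<close> carries two points, which differ in the sign of \<open>n\<^sub>i\<close>.
\<close>

section \<open>Coordinates: index type, metric and potential in the diagonal frame\<close>

lemma UNIV_4_zero: "(UNIV :: 4 set) = {0, 1, 2, 3}"
proof -
  have "(4::4) = 0" by simp
  then have "(UNIV :: 4 set) = {1, 2, 3, 0}" by (simp only: UNIV_4)
  then show ?thesis by (simp only: insert_commute)
qed

lemma Compl_zero_4: "- {0 :: 4} = {1, 2, 3}"
  unfolding Compl_eq_Diff_UNIV UNIV_4_zero by auto

lemma forall_4_zero: "(\<forall>i::4. P i) \<longleftrightarrow> P 0 \<and> P 1 \<and> P 2 \<and> P 3"
proof -
  have "(\<forall>i::4. P i) \<longleftrightarrow> (\<forall>i\<in>{0, 1, 2, 3}. P i)"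
    unfolding UNIV_4_zero[symmetric] by simp
  then show ?thesis by simp
qed

lemma lower_vec_nth: "lower_vec x $ i = (if i = 0 then x $ i else - x $ i)"
proof -
  have "metric $ i $ j * x $ j = (if j = i then (if i = 0 then x $ i else - x $ i) else 0)" for j
    by (simp add: metric_def)
  then show ?thesis
    by (simp add: lower_vec_def matrix_vector_mult_def)
qed

text \<open>Lowering multiplies each entry by the metric signs of its two indices. On the diagonal
  these signs agree and cancel, and off it the entry is 0.\<close>

lemma lower_tensor_prototype: "lower_tensor (prototype_tensor \<Lambda>) = prototype_tensor \<Lambda>"
proof -
  let ?g = "\<lambda>i::4. if i = 0 then 1 else - 1 :: real"
  have 1: "(metric ** A) $ i $ j = ?g i * A $ i $ j" for A i j
  proof -
    have "metric $ i $ k * A $ k $ j = (if k = i then ?g i * A $ i $ j else 0)" for k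
      by (simp add: metric_def)
    then show ?thesis by (simp add: matrix_matrix_mult_def)
  qed
  have 2: "(A ** metric) $ i $ j = A $ i $ j * ?g j" for A i j
  proof -
    have "A $ i $ k * metric $ k $ j = (if k = j then A $ i $ j * ?g j else 0)" for k
      by (simp add: metric_def)
    then show ?thesis by (simp add: matrix_matrix_mult_def)
  qed
  have "lower_tensor (prototype_tensor \<Lambda>) $ i $ j = prototype_tensor \<Lambda> $ i $ j" for i j
    unfolding lower_tensor_def 1 2 by (cases "i = j") (auto simp: prototype_tensor_def)
  then show ?thesis
    unfolding vec_eq_iff by blast
qed

lemma quartic_form_prototype:
  "quartic_form (prototype_tensor \<Lambda>) r = (\<Sum>i\<in>UNIV. lower_vec \<Lambda> $ i * (r $ i)\<^sup>2)"
proof -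
  have "prototype_tensor \<Lambda> $ i $ j * r $ i * r $ j
      = (if j = i then lower_vec \<Lambda> $ i * (r $ i)\<^sup>2 else 0)" for i j
    by (simp add: prototype_tensor_def lower_vec_nth power2_eq_square)
  then show ?thesis
    by (simp add: quartic_form_def lower_tensor_prototype)
qed

lemma potential_prototype:
  "potential M (prototype_tensor \<Lambda>) \<phi> =
    (\<Sum>i\<in>UNIV. 1/2 * lower_vec \<Lambda> $ i * (orbit_vec \<phi> $ i)\<^sup>2 - lower_vec M $ i * orbit_vec \<phi> $ i)"
  by (simp add: potential_def quartic_form_prototype sum_subtractf sum_distrib_left mult.assoc)

lemma minkowski_self: "minkowski x x = (\<Sum>i\<in>UNIV. lower_vec 1 $ i * (x $ i)\<^sup>2)"
  unfolding minkowski_def by (rule sum.cong) (auto simp: lower_vec_nth power2_eq_square)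

lemma minkowski_expand:
  "minkowski x x = (x $ 0)\<^sup>2 - (x $ 1)\<^sup>2 - (x $ 2)\<^sup>2 - (x $ 3)\<^sup>2"
  unfolding minkowski_self UNIV_4_zero by (simp add: lower_vec_nth)

lemma herm_expand: "herm x y = cnj (x $ 1) * y $ 1 + cnj (x $ 2) * y $ 2"
  by (simp add: herm_def sum_2)

lemma fourvec_nth [simp]:
  "fourvec a b c d $ 0 = a" "fourvec a b c d $ 1 = b"
  "fourvec a b c d $ 2 = c" "fourvec a b c d $ 3 = d"
  by (simp_all add: fourvec_def)

section \<open>Stationarity of null vectors in field space\<close>

text \<open>The Minkowski square is four times the squared modulus of the determinant whose columns
  are the two doublets.\<close>

lemma minkowski_orbit_vec_nonneg: "minkowski (orbit_vec \<phi>) (orbit_vec \<phi>) \<ge> 0"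
proof -
  define a b c d where "a = fst \<phi> $ 1" and "b = fst \<phi> $ 2" and "c = snd \<phi> $ 1" and "d = snd \<phi> $ 2"
  have "minkowski (orbit_vec \<phi>) (orbit_vec \<phi>) = 4 * (norm (a * d - b * c))\<^sup>2"
    unfolding cmod_power2 minkowski_expand orbit_vec_def
    by (simp add: herm_expand a_def[symmetric] b_def[symmetric] c_def[symmetric] d_def[symmetric]
          power2_eq_square algebra_simps)
  then show ?thesis by simp
qed

lemma orbit_vec_differentiable: "(\<lambda>\<phi>. orbit_vec \<phi> $ i) differentiable (at \<phi>)"
proof -
  have nth: "(\<lambda>\<phi>::doublets. fst \<phi> $ k) differentiable (at \<phi>)"
            "(\<lambda>\<phi>::doublets. snd \<phi> $ k) differentiable (at \<phi>)" for k
    by (intro bounded_linear_imp_differentiable bounded_linear_compose[OF bounded_linear_vec_nth]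
        bounded_linear_fst bounded_linear_snd)+
  have *: "(\<lambda>\<phi>::doublets. Re (cnj (f \<phi>) * g \<phi>)) differentiable (at \<phi>)"
       "(\<lambda>\<phi>::doublets. Im (cnj (f \<phi>) * g \<phi>)) differentiable (at \<phi>)"
    if f: "f differentiable (at \<phi>)" and g: "g differentiable (at \<phi>)" for f g
  proof -
    obtain f' g' where "(f has_derivative f') (at \<phi>)" "(g has_derivative g') (at \<phi>)"
      using f g unfolding differentiable_def by blast
    then have D: "((\<lambda>\<phi>. cnj (f \<phi>) * g \<phi>) has_derivative (\<lambda>h. cnj (f \<phi>) * g' h + cnj (f' h) * g \<phi>)) (at \<phi>)"
      by (intro has_derivative_mult bounded_linear.has_derivative[OF bounded_linear_cnj])
    show "(\<lambda>\<phi>::doublets. Re (cnj (f \<phi>) * g \<phi>)) differentiable (at \<phi>)"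
       "(\<lambda>\<phi>::doublets. Im (cnj (f \<phi>) * g \<phi>)) differentiable (at \<phi>)"
      using bounded_linear.has_derivative[OF bounded_linear_Re D]
        bounded_linear.has_derivative[OF bounded_linear_Im D]
      by (auto simp only: differentiable_def)
  qed
  have "\<forall>i. (\<lambda>\<phi>. orbit_vec \<phi> $ i) differentiable (at \<phi>)"
    unfolding forall_4_zero orbit_vec_def fourvec_nth herm_expand plus_complex.sel
    by (intro conjI differentiable_add differentiable_diff differentiable_mult
        differentiable_const * nth)
  then show ?thesis ..
qed

text \<open>A null configuration minimises the nonnegative Minkowski square over all fields, so the
  derivative of that square vanishes there. The hypothesis on \<open>M\<close> makes the derivative
  of the potential \<open>\<zeta>/2\<close> times this vanishing derivative.\<close>

lemma prototype_stationary:
  assumes null: "minkowski (orbit_vec \<phi>) (orbit_vec \<phi>) = 0"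
    and M: "\<And>i. (\<Lambda> $ i - \<zeta>) * orbit_vec \<phi> $ i = M $ i"
  shows "GDERIV (potential M (prototype_tensor \<Lambda>)) \<phi> :> 0"
proof -
  define r where "r = orbit_vec \<phi>"
  obtain D where D: "\<And>i. ((\<lambda>\<phi>. orbit_vec \<phi> $ i) has_derivative D i) (at \<phi>)"
    using orbit_vec_differentiable[of _ \<phi>] unfolding differentiable_def by metis
  have sq: "((\<lambda>\<phi>. c * (orbit_vec \<phi> $ i)\<^sup>2) has_derivative (\<lambda>h. 2 * (c * r $ i * D i h))) (at \<phi>)"
    for c i
    unfolding power2_eq_square r_def
    by (rule has_derivative_eq_rhs[OF has_derivative_mult_right[OF has_derivative_mult[OF D D]]])
       (simp add: algebra_simps)
  have "((\<lambda>\<phi>. minkowski (orbit_vec \<phi>) (orbit_vec \<phi>)) has_derivative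
      (\<lambda>h. \<Sum>i\<in>UNIV. 2 * (lower_vec 1 $ i * r $ i * D i h))) (at \<phi>)"
    unfolding minkowski_self
    by (intro has_derivative_sum sq)
  then have "(\<lambda>h. \<Sum>i\<in>UNIV. 2 * (lower_vec 1 $ i * r $ i * D i h)) = (\<lambda>h. 0)"
    by (rule differential_zero_maxmin[where S = UNIV, rotated 2])
       (simp_all only: null minkowski_orbit_vec_nonneg UNIV_I open_UNIV simp_thms ball_UNIV)
  from fun_cong[OF this] have tangent: "(\<Sum>i\<in>UNIV. lower_vec 1 $ i * r $ i * D i h) = 0" for h
    by (simp add: sum_distrib_left[symmetric])
  have "(potential M (prototype_tensor \<Lambda>) has_derivative
      (\<lambda>h. \<Sum>i\<in>UNIV. (lower_vec \<Lambda> $ i * r $ i - lower_vec M $ i) * D i h)) (at \<phi>)"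
    unfolding potential_prototype[abs_def]
    by (rule has_derivative_eq_rhs[OF has_derivative_sum[OF
            has_derivative_diff[OF sq has_derivative_mult_right[OF D]]]])
       (simp add: algebra_simps)
  moreover have "(lower_vec \<Lambda> $ i * r $ i - lower_vec M $ i) * D i h
      = \<zeta> * (lower_vec 1 $ i * r $ i * D i h)" for i h
    using M[of i] by (auto simp: lower_vec_nth r_def algebra_simps)
  ultimately show ?thesis
    by (simp add: gderiv_def sum_distrib_left[symmetric] tangent)
qed

text \<open>Null vectors come from proportional doublets, so both can be sought along the first axis
  of the doublet space, the first with a real entry \<open>a\<close>. Only \<open>a\<close> and a
  complex \<open>b\<close> remain to be found.\<close>

lemma null_orbit_vec_exists:
  assumes r0: "r $ 0 \<ge> 0" and null: "minkowski r r = 0"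
  shows "\<exists>\<phi>. orbit_vec \<phi> = r"
proof -
  have sq: "(r $ 1)\<^sup>2 + (r $ 2)\<^sup>2 = (r $ 0 + r $ 3) * (r $ 0 - r $ 3)"
    using null by (simp add: minkowski_expand power2_eq_square algebra_simps)
  have "(r $ 0)\<^sup>2 \<ge> (r $ 3)\<^sup>2"
    using sq by (simp add: power2_eq_square algebra_simps) (smt (verit) zero_le_square)
  then have le: "\<bar>r $ 3\<bar> \<le> r $ 0"
    using r0 abs_le_square_iff[of "r $ 3" "r $ 0"] by simp
  have orbit: "orbit_vec (vector [complex_of_real a, 0], vector [b, 0])
      = fourvec (a\<^sup>2 + (cmod b)\<^sup>2) (2 * a * Re b) (2 * a * Im b) (a\<^sup>2 - (cmod b)\<^sup>2)" for a b
    unfolding cmod_power2 by (simp add: orbit_vec_def herm_expand power2_eq_square mult.assoc)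
  show ?thesis
  proof (cases "r $ 0 + r $ 3 = 0")
    case True
    then have "r $ 1 = 0" "r $ 2 = 0"
      using sq by (simp_all add: sum_power2_eq_zero_iff)
    then have "orbit_vec (vector [complex_of_real 0, 0], vector [of_real (sqrt (r $ 0)), 0]) = r"
      using True r0 unfolding orbit by (simp add: vec_eq_iff forall_4_zero)
    then show ?thesis ..
  next
    case False
    \<comment> \<open>Solves \<open>r $ 0 + r $ 3 = 2 * a\<^sup>2\<close> and, with
      \<open>r $ 1\<close> and \<open>r $ 2\<close> as real and imaginary part,
      \<open>2 * a * b\<close>; the remaining equation for the modulus of \<open>b\<close> is
      nullness.\<close>
    define a where "a = sqrt ((r $ 0 + r $ 3) / 2)"
    define b where "b = Complex (r $ 1) (r $ 2) / (2 * complex_of_real a)"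
    have a2: "a\<^sup>2 = (r $ 0 + r $ 3) / 2" and a: "a > 0"
      using False le by (auto simp: a_def)
    have "(cmod b)\<^sup>2 = ((r $ 1)\<^sup>2 + (r $ 2)\<^sup>2) / (4 * a\<^sup>2)"
      by (simp add: b_def norm_divide norm_mult power_divide power_mult_distrib cmod_power2)
    also have "\<dots> = (r $ 0 - r $ 3) / 2"
      using False by (simp add: sq a2 field_simps)
    finally have b2: "(cmod b)\<^sup>2 = (r $ 0 - r $ 3) / 2" .
    have "Complex (r $ 1) (r $ 2) = complex_of_real (2 * a) * b"
      using a by (simp add: b_def)
    then have "2 * a * Re b = r $ 1" "2 * a * Im b = r $ 2"
      by (simp_all add: complex_eq_iff)
    then have "orbit_vec (vector [complex_of_real a, 0], vector [b, 0]) = r"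
      unfolding orbit a2 b2 by (simp add: vec_eq_iff forall_4_zero field_simps)
    then show ?thesis ..
  qed
qed

lemma neutral_stationary_pointI:
  assumes "r $ 0 > 0" and null: "minkowski r r = 0"
    and "\<And>i. (\<Lambda> $ i - \<zeta>) * r $ i = M $ i"
  shows "r \<in> neutral_stationary_points M (prototype_tensor \<Lambda>)"
proof -
  obtain \<phi> where \<phi>: "orbit_vec \<phi> = r"
    using null_orbit_vec_exists[of r] assms by auto
  then have "GDERIV (potential M (prototype_tensor \<Lambda>)) \<phi> :> 0"
    using assms by (intro prototype_stationary) auto
  moreover have "r \<noteq> 0" using assms by auto
  ultimately show ?thesis
    using \<phi> null unfolding neutral_stationary_points_def by blast
qed

section \<open>Counting, convexity and the intermediate value theorem\<close>

lemma has_at_least_mono: "has_at_least n A \<Longrightarrow> A \<subseteq> B \<Longrightarrow> has_at_least n B"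
  unfolding has_at_least_def by blast

lemma has_at_least_Un:
  assumes "has_at_least m A" "has_at_least n B" "A \<inter> B = {}"
  shows "has_at_least (m + n) (A \<union> B)"
proof -
  obtain S S' where "S \<subseteq> A" "finite S" "card S = m" "S' \<subseteq> B" "finite S'" "card S' = n"
    using assms unfolding has_at_least_def by auto
  moreover from this assms have "card (S \<union> S') = m + n"
    by (subst card_Un_disjoint) auto
  ultimately show ?thesis
    unfolding has_at_least_def by (intro exI[of _ "S \<union> S'"]) auto
qed

lemma has_at_least_1: "x \<in> A \<Longrightarrow> has_at_least 1 A"
  unfolding has_at_least_def by (intro exI[of _ "{x}"]) auto

lemma has_at_least_2: "x \<in> A \<Longrightarrow> y \<in> A \<Longrightarrow> x \<noteq> y \<Longrightarrow> has_at_least 2 A"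
  unfolding has_at_least_def by (intro exI[of _ "{x, y}"]) auto

text \<open>On the positive axis this combines convexity of the inverse with convexity of squaring;
  two negative arguments are reduced to it by a change of sign.\<close>

lemma inverse_square_convex:
  fixes A C u :: real
  assumes "A * C > 0" "0 \<le> u" "u \<le> 1"
  shows "(1 / ((1 - u) * A + u * C))\<^sup>2 \<le> (1 - u) * (1 / A)\<^sup>2 + u * (1 / C)\<^sup>2"
proof -
  have pos: "(1 / ((1 - u) * A + u * C))\<^sup>2 \<le> (1 - u) * (1 / A)\<^sup>2 + u * (1 / C)\<^sup>2"
    if "A > 0" "C > 0" for A C
  proof -
    have y: "(1 - u) * A + u * C > 0"
      using that assms by (metis add_pos_nonneg add_nonneg_pos add_0 diff_ge_0_iff_ge diff_zero
          less_eq_real_def mult_1 mult_nonneg_nonneg mult_pos_pos mult_zero_left diff_gt_0_iff_gt)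
    have "inverse ((1 - u) * A + u * C) \<le> (1 - u) * inverse A + u * inverse C"
      using convex_onD[OF convex_on_inverse[of "{0<..}"], of u A C] that assms by auto
    then have "(inverse ((1 - u) * A + u * C))\<^sup>2 \<le> ((1 - u) * inverse A + u * inverse C)\<^sup>2"
      using y by (intro power_mono) auto
    also have "\<dots> \<le> (1 - u) * (inverse A)\<^sup>2 + u * (inverse C)\<^sup>2"
      using convex_onD[OF convex_power2, of u "inverse A" "inverse C"] assms by auto
    finally show ?thesis by (simp add: inverse_eq_divide)
  qed
  show ?thesis
  proof (cases "A > 0")
    case True
    then show ?thesis using pos assms by (simp add: zero_less_mult_iff)
  next
    case False
    then have neg: "- A > 0" "- C > 0"
      using assms by (auto simp: zero_less_mult_iff)
    have "(1 - u) * - A + u * - C = - ((1 - u) * A + u * C)" by simp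
    then show ?thesis using pos[OF neg] by (simp only: minus_divide_right[symmetric] power2_minus)
  qed
qed

text \<open>The endpoints are not ordered, so that one statement serves both sides of a
  pole.\<close>

lemma ivt_segment:
  fixes f :: "real \<Rightarrow> real"
  assumes "continuous_on (closed_segment a b) f" "f a \<ge> 0" "f b \<le> 0"
  obtains x where "x \<in> closed_segment a b" "f x = 0"
proof -
  have "connected (f ` closed_segment a b)"
    using assms by (intro connected_continuous_image) auto
  then have "0 \<in> f ` closed_segment a b"
    using assms by (auto intro: connectedD_interval[where x = "f b" and y = "f a"])
  then show ?thesis using that by auto
qed

lemma minkowski_split: "minkowski x x = (x $ 0)\<^sup>2 - (\<Sum>i\<in>-{0}. (x $ i)\<^sup>2)"
proof -
  have "minkowski x x = (\<Sum>i\<in>insert 0 (-{0}). lower_vec 1 $ i * (x $ i)\<^sup>2)"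
    unfolding minkowski_self by (rule sum.cong) auto
  also have "\<dots> = (x $ 0)\<^sup>2 + (\<Sum>i\<in>-{0}. lower_vec 1 $ i * (x $ i)\<^sup>2)"
    by (subst sum.insert) (auto simp: lower_vec_nth)
  also have "(\<Sum>i\<in>-{0}. lower_vec 1 $ i * (x $ i)\<^sup>2) = (\<Sum>i\<in>-{0}. - (x $ i)\<^sup>2)"
    by (rule sum.cong) (auto simp: lower_vec_nth)
  finally show ?thesis by (simp add: sum_negf)
qed

lemma pole_term_tendsto: "d > 0 \<Longrightarrow> ((\<lambda>T. (m / (\<mu> - d * T))\<^sup>2) \<longlongrightarrow> 0) at_top"
  for m \<mu> d :: real
proof -
  assume "d > 0"
  then have "filterlim (\<lambda>T. \<mu> - d * T) at_bot at_top" by real_asymp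
  then have "((\<lambda>T. m / (\<mu> - d * T)) \<longlongrightarrow> 0) at_top"
    by (intro tendsto_divide_0[OF tendsto_const] filterlim_at_bot_imp_at_infinity) simp
  from tendsto_power[OF this, of 2] show ?thesis by simp
qed

section \<open>The secular function and the points over its zeros\<close>

locale prototypical_model =
  fixes M \<Lambda> :: "real^4"
  assumes \<Lambda>_less: "\<Lambda> $ 0 > \<Lambda> $ 3" "\<Lambda> $ 3 > \<Lambda> $ 2" "\<Lambda> $ 2 > \<Lambda> $ 1"
begin

definition gap :: "4 \<Rightarrow> real" where "gap i = \<Lambda> $ 0 - \<Lambda> $ i"

definition pole :: "4 \<Rightarrow> real" where "pole i = M $ 0 / gap i"

definition secular :: "real \<Rightarrow> real" where
  "secular T = (\<Sum>i\<in>-{0}. (M $ i / (M $ 0 - gap i * T))\<^sup>2) - 1"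

text \<open>Where \<open>M $ i = 0\<close>, the convention \<open>x / 0 = 0\<close> removes the singularity at \<open>pole i\<close>.\<close>

definition regular :: "real \<Rightarrow> bool" where
  "regular T \<longleftrightarrow> (\<forall>i. i \<noteq> 0 \<longrightarrow> M $ 0 = gap i * T \<longrightarrow> M $ i = 0)"

text \<open>Sorting the points by \<open>r $ 0\<close>, which is the variable \<open>T\<close> of
  \<open>secular\<close>, makes disjoint ranges of \<open>T\<close> contribute disjoint sets of
  points.\<close>

definition points :: "real set \<Rightarrow> (real^4) set" where
  "points A = {r \<in> neutral_stationary_points M (prototype_tensor \<Lambda>). r $ 0 \<in> A}"

lemma nonzero_index_cases: "i \<noteq> 0 \<Longrightarrow> i = 1 \<or> i = 2 \<or> i = (3::4)"
  using UNIV_4_zero by blast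

lemma gap_pos: "i \<noteq> 0 \<Longrightarrow> gap i > 0"
  using nonzero_index_cases[of i] \<Lambda>_less by (auto simp: gap_def)

lemma gap_inj: "i \<noteq> 0 \<Longrightarrow> j \<noteq> 0 \<Longrightarrow> gap i = gap j \<Longrightarrow> i = j"
  using nonzero_index_cases[of i] nonzero_index_cases[of j] \<Lambda>_less by (auto simp: gap_def)

lemma pole_iff: "i \<noteq> 0 \<Longrightarrow> M $ 0 = gap i * T \<longleftrightarrow> T = pole i"
  using gap_pos[of i] by (auto simp: pole_def field_simps)

lemma regular_if_not_pole: "(\<And>i. i \<noteq> 0 \<Longrightarrow> pole i \<noteq> T) \<Longrightarrow> regular T"
  by (auto simp: regular_def pole_iff)

text \<open>A term whose denominator vanishes at a regular \<open>T\<close> has numerator 0 and is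
  therefore constantly 0.\<close>

lemma isCont_secular:
  assumes "regular T"
  shows "isCont secular T"
proof -
  have "isCont (\<lambda>T. (M $ i / (M $ 0 - gap i * T))\<^sup>2) T" if "i \<in> -{0}" for i
  proof (cases "M $ 0 = gap i * T")
    case True
    then have "M $ i = 0" using assms that by (auto simp: regular_def)
    then show ?thesis by simp
  next
    case False
    then show ?thesis by (intro continuous_intros) auto
  qed
  then show ?thesis
    unfolding secular_def[abs_def] by (intro isCont_diff isCont_sum continuous_const) blast+
qed

lemma point_of_direction:
  assumes "T > 0" and n: "\<And>i. i \<noteq> 0 \<Longrightarrow> (M $ 0 - gap i * T) * n i = M $ i"
    and norm: "(\<Sum>i\<in>-{0}. (n i)\<^sup>2) = 1"
  shows "(\<chi> i. if i = 0 then T else T * n i) \<in> points {T}"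
proof -
  let ?r = "\<chi> i. if i = 0 then T else T * n i"
  have "minkowski ?r ?r = T\<^sup>2 - (\<Sum>i\<in>-{0}. T\<^sup>2 * (n i)\<^sup>2)"
    by (simp add: minkowski_split power_mult_distrib)
  also have "\<dots> = 0"
    by (simp add: sum_distrib_left[symmetric] norm)
  finally have null: "minkowski ?r ?r = 0" .
  \<comment> \<open>The time component of the stationarity equation forces the multiplier
    \<open>\<Lambda> $ 0 - M $ 0 / T\<close>; the spatial components then become the hypothesis on
    \<open>n\<close>.\<close>
  have "(\<Lambda> $ i - (\<Lambda> $ 0 - M $ 0 / T)) * ?r $ i = M $ i" for i
  proof (cases "i = 0")
    case True
    then show ?thesis using \<open>T > 0\<close> by simp
  next
    case False
    have "(\<Lambda> $ i - (\<Lambda> $ 0 - M $ 0 / T)) * T = M $ 0 - gap i * T"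
      using \<open>T > 0\<close> by (simp add: gap_def field_simps)
    then show ?thesis using False n[of i] by (simp add: mult.assoc[symmetric])
  qed
  then have "?r \<in> neutral_stationary_points M (prototype_tensor \<Lambda>)"
    using \<open>T > 0\<close> null by (intro neutral_stationary_pointI[where \<zeta> = "\<Lambda> $ 0 - M $ 0 / T"]) auto
  then show ?thesis by (simp add: points_def)
qed

text \<open>The direction is \<open>M $ i / (M $ 0 - gap i * T)\<close>, and a zero of
  \<open>secular\<close> says that it has unit length. Where the denominator vanishes, regularity
  makes the equation read \<open>0 = 0\<close>.\<close>

lemma point_of_root:
  assumes "T > 0" "regular T" "secular T = 0"
  shows "has_at_least 1 (points {T})"
proof (rule has_at_least_1, rule point_of_direction)
  show "(M $ 0 - gap i * T) * (M $ i / (M $ 0 - gap i * T)) = M $ i" if "i \<noteq> 0" for i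
    using assms that by (auto simp: regular_def)
  show "(\<Sum>i\<in>-{0}. (M $ i / (M $ 0 - gap i * T))\<^sup>2) = 1"
    using assms by (simp add: secular_def)
qed (use assms in auto)

text \<open>The missing part of the norm is supplied by \<open>r $ j\<close>, which is unconstrained at \<open>pole j\<close>.\<close>

lemma points_of_negative_pole:
  assumes j: "j \<noteq> 0" "M $ j = 0" and pos: "pole j > 0" and neg: "secular (pole j) < 0"
  shows "has_at_least 2 (points {pole j})"
proof -
  let ?T = "pole j"
  let ?s = "sqrt (- secular ?T)"
  define n where "n \<sigma> i = (if i = j then \<sigma> * ?s else M $ i / (M $ 0 - gap i * ?T))" for \<sigma> :: real and i
  have other: "M $ 0 \<noteq> gap i * ?T" if "i \<noteq> 0" "i \<noteq> j" for i
    using that j pos gap_inj[of i j] gap_pos[of i] gap_pos[of j] by (auto simp: pole_def field_simps)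
  have sol: "(\<chi> i. if i = 0 then ?T else ?T * n \<sigma> i) \<in> points {?T}" if \<sigma>: "\<sigma>\<^sup>2 = 1" for \<sigma>
  proof (rule point_of_direction[OF pos])
    show "(M $ 0 - gap i * ?T) * n \<sigma> i = M $ i" if "i \<noteq> 0" for i
      using that other[of i] j pole_iff[of j ?T] by (auto simp: n_def)
    have jin: "j \<in> -{0}" using j by simp
    have "(\<Sum>i\<in>-{0}. (n \<sigma> i)\<^sup>2) = - secular ?T + (\<Sum>i\<in>-{0} - {j}. (M $ i / (M $ 0 - gap i * ?T))\<^sup>2)"
      using neg \<sigma> by (subst sum.remove[OF _ jin]) (auto simp: n_def power_mult_distrib intro!: sum.cong)
    \<comment> \<open>The \<open>j\<close>-th term of \<open>secular\<close> is 0 because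
      \<open>M $ j = 0\<close>, so the remaining terms add up to
      \<open>1 + secular (pole j)\<close>.\<close>
    also have "\<dots> = 1"
      using j by (simp add: secular_def sum.remove[OF _ jin])
    finally show "(\<Sum>i\<in>-{0}. (n \<sigma> i)\<^sup>2) = 1" .
  qed
  have "(\<chi> i. if i = 0 then ?T else ?T * n 1 i) $ j \<noteq> (\<chi> i. if i = 0 then ?T else ?T * n (-1) i) $ j"
    using j pos neg by (simp add: n_def)
  then have "(\<chi> i. if i = 0 then ?T else ?T * n 1 i) \<noteq> (\<chi> i. if i = 0 then ?T else ?T * n (-1) i)"
    by metis
  then show ?thesis
    by (intro has_at_least_2[OF sol[of 1] sol[of "-1"]]) simp_all
qed

text \<open>The \<open>j\<close>-th term alone is at least 1. This explicit bound takes the place of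
  the divergence at the pole.\<close>

lemma secular_nonneg_near_pole:
  assumes "j \<noteq> 0" "(M $ 0 - gap j * T)\<^sup>2 \<le> (M $ j)\<^sup>2" "T \<noteq> pole j"
  shows "secular T \<ge> 0"
proof -
  have "M $ 0 - gap j * T \<noteq> 0" using assms pole_iff[of j T] by auto
  then have "1 \<le> (M $ j / (M $ 0 - gap j * T))\<^sup>2"
    using assms by (simp add: power_divide)
  also have "\<dots> \<le> (\<Sum>i\<in>-{0}. (M $ i / (M $ 0 - gap i * T))\<^sup>2)"
    using assms by (intro member_le_sum) auto
  finally show ?thesis by (simp add: secular_def)
qed

text \<open>The intermediate value theorem is applied between \<open>c\<close> and a point
  \<open>q\<close> with \<open>secular q \<ge> 0\<close>. If the pole is removable, \<open>q\<close>
  is the pole itself; otherwise \<open>q\<close> stops short of it, where the \<open>j\<close>-th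
  term has reached 1.\<close>

lemma root_towards_pole:
  assumes j: "j \<noteq> 0" and c: "secular c < 0"
    and reg: "\<And>x. x \<in> closed_segment (pole j) c \<Longrightarrow> x \<noteq> pole j \<Longrightarrow> regular x"
    and reg_pole: "M $ j = 0 \<Longrightarrow> regular (pole j)"
    and nonneg: "M $ j = 0 \<Longrightarrow> secular (pole j) \<ge> 0"
    and ne: "c \<noteq> pole j"
  obtains T where "T \<in> closed_segment (pole j) c" "T \<noteq> c" "regular T" "secular T = 0"
proof -
  let ?p = "pole j"
  have "\<exists>q\<in>closed_segment ?p c. secular q \<ge> 0 \<and> (\<forall>x\<in>closed_segment q c. regular x)"
  proof (cases "M $ j = 0")
    case True
    then show ?thesis using reg reg_pole nonneg by (metis ends_in_segment(1))
  next
    case False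
    \<comment> \<open>The fraction of the way from the pole to \<open>c\<close> at which the
      \<open>j\<close>-th term of \<open>secular\<close> equals 1.\<close>
    define s where "s = \<bar>M $ j\<bar> / (gap j * \<bar>c - ?p\<bar>)"
    have s0: "s > 0" using False ne gap_pos[OF j] by (simp add: s_def)
    have eq: "M $ 0 - gap j * T = gap j * (?p - T)" for T
      using gap_pos[OF j] by (simp add: pole_def field_simps)
    \<comment> \<open>For \<open>s \<ge> 1\<close> the point \<open>c\<close> would itself be close
      enough to the pole to give \<open>secular c \<ge> 0\<close>.\<close>
    have s1: "s < 1"
    proof (rule ccontr)
      assume "\<not> s < 1"
      then have "gap j * \<bar>c - ?p\<bar> \<le> \<bar>M $ j\<bar>"
        using gap_pos[OF j] ne by (simp add: s_def field_simps)
      then have "\<bar>M $ 0 - gap j * c\<bar> \<le> \<bar>M $ j\<bar>"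
        using gap_pos[OF j] by (simp add: eq abs_mult abs_minus_commute)
      then have "secular c \<ge> 0"
        using j ne by (intro secular_nonneg_near_pole[of j]) (auto simp: abs_le_square_iff)
      then show False using c by simp
    qed
    define q where "q = ?p + s * (c - ?p)"
    have "\<bar>M $ 0 - gap j * q\<bar> = \<bar>M $ j\<bar>"
      using gap_pos[OF j] ne s0 by (simp add: eq q_def abs_mult s_def)
    moreover have "q \<noteq> ?p" using s0 ne by (simp add: q_def)
    ultimately have "secular q \<ge> 0"
      using j by (intro secular_nonneg_near_pole[of j]) (auto simp: abs_le_square_iff[symmetric])
    moreover have q: "q \<in> closed_segment ?p c"
      unfolding in_segment using s0 s1 by (intro exI[of _ s]) (auto simp: q_def algebra_simps)
    moreover have "regular x" if "x \<in> closed_segment q c" for x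
    proof (rule reg)
      show "x \<in> closed_segment ?p c"
        using that q by (meson closed_segment_subset convex_closed_segment ends_in_segment(2) subsetD)
      show "x \<noteq> ?p"
      proof (cases "?p < c")
        case True
        then have "?p < q" using s0 by (simp add: q_def)
        with that True q show ?thesis by (auto simp: closed_segment_eq_real_ivl split: if_splits)
      next
        case False
        then have "c < ?p" using ne by simp
        then have "q < ?p" using s0 by (simp add: q_def mult_pos_neg)
        with that \<open>c < ?p\<close> q show ?thesis by (auto simp: closed_segment_eq_real_ivl split: if_splits)
      qed
    qed
    ultimately show ?thesis by blast
  qed
  then obtain q where q: "q \<in> closed_segment ?p c" "secular q \<ge> 0"
    "\<And>x. x \<in> closed_segment q c \<Longrightarrow> regular x" by blast
  have "continuous_on (closed_segment q c) secular"
    using q isCont_secular by (intro continuous_at_imp_continuous_on) auto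
  then obtain T where T: "T \<in> closed_segment q c" "secular T = 0"
    using ivt_segment[of q c secular] q c by (metis less_eq_real_def)
  moreover have "T \<in> closed_segment ?p c"
    using T q by (meson closed_segment_subset convex_closed_segment ends_in_segment(2) subsetD)
  ultimately show ?thesis using that[of T] q c by force
qed

section \<open>Disjoint ranges of \<open>T\<close>, the limit at infinity, membership in the
  cones\<close>

lemma has_at_least_points_mono:
  "has_at_least n (points A) \<Longrightarrow> A \<subseteq> B \<Longrightarrow> has_at_least n (points B)"
  by (erule has_at_least_mono) (auto simp: points_def)

lemma has_at_least_points_Un:
  assumes "has_at_least m (points A)" "has_at_least n (points B)" "A \<inter> B = {}"
    "A \<union> B \<subseteq> C" "m + n = k"
  shows "has_at_least k (points C)"
proof -
  have "points A \<inter> points B = {}" using assms(3) by (auto simp: points_def)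
  then have "has_at_least k (points A \<union> points B)"
    using has_at_least_Un assms(1,2,5) by metis
  then show ?thesis
    using assms(4) by (elim has_at_least_mono) (auto simp: points_def)
qed

lemma secular_tendsto: "(secular \<longlongrightarrow> - 1) at_top"
proof -
  have "((\<lambda>T. (M $ i / (M $ 0 - gap i * T))\<^sup>2) \<longlongrightarrow> 0) at_top" if "i \<in> -{0}" for i
    using that gap_pos by (intro pole_term_tendsto) auto
  then have "(secular \<longlongrightarrow> (\<Sum>i\<in>-{0::4}. 0) - 1) at_top"
    unfolding secular_def[abs_def] by (intro tendsto_diff tendsto_sum tendsto_const) blast
  then show ?thesis by simp
qed

lemma secular_eventually_negative:
  obtains c where "c > b" "c > 0" "secular c < 0"
proof -
  have "\<forall>\<^sub>F T in at_top. secular T < 0"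
    using order_tendstoD(2)[OF secular_tendsto, of 0] by simp
  moreover have "\<forall>\<^sub>F T in at_top. T > max b 0" by (rule eventually_gt_at_top)
  ultimately have "\<forall>\<^sub>F T in at_top. T > max b 0 \<and> secular T < 0"
    by eventually_elim auto
  then obtain c where "c > max b 0" "secular c < 0"
    using eventually_happens' trivial_limit_at_top_linorder by blast
  then show ?thesis using that by auto
qed

text \<open>The parameter \<open>s\<close> is \<open>v\<^sup>2/2\<close>, and \<open>gap k * s = x $ 0\<close> corresponds to \<open>\<zeta> = s \<Lambda>\<^sub>k\<close>.\<close>

lemma caustic_coneE:
  assumes "x \<in> caustic_cone \<Lambda> i" and i: "i = 1 \<or> i = 2"
  obtains s n where "s > 0" "x $ 0 > 0" "x $ 0 \<le> gap i * s" "gap (i + 1) * s \<le> x $ 0"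
    "\<And>k. k \<noteq> 0 \<Longrightarrow> x $ k = (x $ 0 - gap k * s) * n k" "(\<Sum>k\<in>-{0}. (n k)\<^sup>2) = 1"
proof -
  obtain v \<zeta> n1 n2 n3 where v: "v > 0" and x: "x = fourvec (1/2 * v\<^sup>2 * \<Lambda> $ 0 - \<zeta>)
        ((1/2 * v\<^sup>2 * \<Lambda> $ 1 - \<zeta>) * n1) ((1/2 * v\<^sup>2 * \<Lambda> $ 2 - \<zeta>) * n2) ((1/2 * v\<^sup>2 * \<Lambda> $ 3 - \<zeta>) * n3)"
    and \<zeta>: "1/2 * v\<^sup>2 * \<Lambda> $ i \<le> \<zeta>" "\<zeta> \<le> 1/2 * v\<^sup>2 * \<Lambda> $ (i + 1)" and n: "n1\<^sup>2 + n2\<^sup>2 + n3\<^sup>2 = 1"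
    using assms(1) unfolding caustic_cone_def caustic_slice_def by auto
  define s where "s = 1/2 * v\<^sup>2"
  define n where "n k = (if k = 1 then n1 else if k = 2 then n2 else n3)" for k :: 4
  have s: "s > 0" using v by (simp add: s_def)
  have xs: "x = fourvec (s * \<Lambda> $ 0 - \<zeta>)
      ((s * \<Lambda> $ 1 - \<zeta>) * n1) ((s * \<Lambda> $ 2 - \<zeta>) * n2) ((s * \<Lambda> $ 3 - \<zeta>) * n3)"
    by (simp only: x s_def)
  have x0: "x $ 0 = s * \<Lambda> $ 0 - \<zeta>" by (simp add: xs)
  have "i + 1 \<noteq> 0" using i by auto
  then have "s * \<Lambda> $ (i + 1) < s * \<Lambda> $ 0"
    using gap_pos[of "i + 1"] s by (simp add: gap_def)
  then have "x $ 0 > 0" using \<zeta> by (simp add: x0 s_def)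
  moreover have "x $ k = (x $ 0 - gap k * s) * n k" if "k \<noteq> 0" for k
    using nonzero_index_cases[OF that] unfolding x0
    by (auto simp: xs n_def gap_def algebra_simps)
  moreover have "x $ 0 \<le> gap i * s" "gap (i + 1) * s \<le> x $ 0"
    using \<zeta>[folded s_def] by (simp_all add: x0 gap_def algebra_simps)
  moreover have "(\<Sum>k\<in>-{0}. (n k)\<^sup>2) = 1"
    using n by (simp add: Compl_zero_4 n_def)
  ultimately show ?thesis using that s by blast
qed

lemma caustic_cone_future:
  "M \<in> interior (caustic_cone \<Lambda> i) \<Longrightarrow> i = 1 \<or> i = 2 \<Longrightarrow> M $ 0 > 0"
  using caustic_coneE[of M i] interior_subset by blast

text \<open>An interior point can be moved back along the time axis by some \<open>e > 0\<close>
  within the cone; the weak inequalities at the shifted point give the strict ones at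
  \<open>M\<close>.\<close>

lemma interior_LC_plus_future:
  assumes "M \<in> interior LC_plus"
  shows "M $ 0 > 0" "minkowski M M > 0"
proof -
  obtain e where e: "e > 0" "cball M e \<subseteq> LC_plus"
    using assms by (metis mem_interior_cball)
  let ?N = "M - e *\<^sub>R axis 0 1"
  have "?N \<in> LC_plus" using e by (intro subsetD[OF e(2)]) (simp add: dist_norm)
  moreover have "(\<Sum>i\<in>-{0}. (?N $ i)\<^sup>2) = (\<Sum>i\<in>-{0}. (M $ i)\<^sup>2)"
    by (rule sum.cong) (auto simp: axis_def)
  ultimately have N: "M $ 0 - e \<ge> 0" "(M $ 0 - e)\<^sup>2 \<ge> (\<Sum>i\<in>-{0}. (M $ i)\<^sup>2)"
    unfolding LC_plus_def mem_Collect_eq minkowski_split by (auto simp: axis_def)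
  then show "M $ 0 > 0" using e by simp
  have "(M $ 0 - e)\<^sup>2 < (M $ 0)\<^sup>2" using N e by (intro power_strict_mono) auto
  then show "minkowski M M > 0" using N by (simp add: minkowski_split)
qed

section \<open>Nonpositive \<open>M $ 0\<close>\<close>

text \<open>Here \<open>M\<close> is spacelike and \<open>secular\<close> has no pole on the
  positive axis. For \<open>M $ 0 < 0\<close> it falls from a positive value at 0 to negative
  values.\<close>

lemma point_of_nonfuture:
  assumes M: "M \<notin> LC_minus" and M0: "M $ 0 \<le> 0"
  shows "has_at_least 1 (points UNIV)"
proof -
  have "- M \<notin> LC_plus" using M unfolding LC_minus_def by (metis imageI minus_minus)
  then have spacelike: "(M $ 0)\<^sup>2 < (\<Sum>i\<in>-{0}. (M $ i)\<^sup>2)"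
    using M0 by (auto simp: LC_plus_def minkowski_split)
  have reg: "regular T" if "T \<ge> 0" "T > 0 \<or> M $ 0 < 0" for T
    unfolding regular_def
  proof (intro allI impI)
    fix i :: 4 assume "i \<noteq> 0" "M $ 0 = gap i * T"
    then show "M $ i = 0" using gap_pos[of i] that M0 by (metis mult_nonneg_nonneg mult_pos_pos not_less less_imp_le)
  qed
  have "\<exists>T>0. secular T = 0"
  proof (cases "M $ 0 = 0")
    case True
    \<comment> \<open>For \<open>M $ 0 = 0\<close> all poles merge at 0 and the secular equation is
      solved explicitly.\<close>
    define T where "T = sqrt (\<Sum>i\<in>-{0}. (M $ i / gap i)\<^sup>2)"
    have "(\<Sum>i\<in>-{0}. (M $ i)\<^sup>2) \<noteq> 0" using spacelike True by simp
    then obtain i where i: "i \<in> -{0}" "(M $ i)\<^sup>2 \<noteq> 0" by (rule sum.not_neutral_contains_not_neutral)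
    then have "gap i \<noteq> 0" using gap_pos[of i] by auto
    then have "0 < (M $ i / gap i)\<^sup>2" using i by simp
    also have "\<dots> \<le> (\<Sum>i\<in>-{0}. (M $ i / gap i)\<^sup>2)"
      using i by (intro member_le_sum) auto
    finally have T: "T > 0" "T\<^sup>2 = (\<Sum>i\<in>-{0}. (M $ i / gap i)\<^sup>2)" by (auto simp: T_def)
    have "(M $ i / (M $ 0 - gap i * T))\<^sup>2 = (M $ i / gap i)\<^sup>2 / T\<^sup>2" for i
      using True by (simp add: power_divide power_mult_distrib)
    then have "secular T = 0"
      using T(1) by (simp add: secular_def sum_divide_distrib[symmetric] flip: T(2))
    then show ?thesis using T by blast
  next
    case False
    then have "M $ 0 < 0" using M0 by simp
    have "secular 0 = (\<Sum>i\<in>-{0}. (M $ i)\<^sup>2) / (M $ 0)\<^sup>2 - 1"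
      by (simp add: secular_def power_divide sum_divide_distrib)
    then have "secular 0 > 0" using spacelike False by simp
    obtain c where c: "c > 0" "secular c < 0" using secular_eventually_negative[of 0] by metis
    have "continuous_on (closed_segment 0 c) secular"
      using c reg \<open>M $ 0 < 0\<close> by (intro continuous_at_imp_continuous_on ballI isCont_secular)
        (auto simp: closed_segment_eq_real_ivl)
    then obtain T where "T \<in> closed_segment 0 c" "secular T = 0"
      using ivt_segment[of 0 c secular] \<open>secular 0 > 0\<close> c by (metis less_eq_real_def)
    then show ?thesis
      using \<open>secular 0 > 0\<close> c by (auto simp: closed_segment_eq_real_ivl intro!: exI[of _ T] order_neq_le_trans)
  qed
  then obtain T where "T > 0" "secular T = 0" by blast
  then have "has_at_least 1 (points {T})" using reg by (intro point_of_root) auto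
  then show ?thesis by (rule has_at_least_points_mono) auto
qed

end

section \<open>Positive \<open>M $ 0\<close>: zeros around the poles\<close>

locale future_model = prototypical_model +
  assumes M0_pos: "M $ 0 > 0"
begin

lemma pole_pos: "i \<noteq> 0 \<Longrightarrow> pole i > 0"
  using M0_pos gap_pos by (simp add: pole_def)

lemma pole_inj: "i \<noteq> 0 \<Longrightarrow> j \<noteq> 0 \<Longrightarrow> pole i = pole j \<Longrightarrow> i = j"
  using gap_inj[of i j] gap_pos[of i] gap_pos[of j] M0_pos by (auto simp: pole_def field_simps)

lemma pole_less: "pole 1 < pole 2" "pole 2 < pole 3"
  using gap_pos[of 1] gap_pos[of 2] gap_pos[of 3] M0_pos \<Lambda>_less
  by (auto simp: pole_def gap_def intro!: divide_strict_left_mono)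

lemma regular_pole: "i \<noteq> 0 \<Longrightarrow> M $ i = 0 \<Longrightarrow> regular (pole i)"
  using pole_inj by (auto simp: regular_def pole_iff)

text \<open>A removable pole with a negative value carries two points; otherwise a zero lies between
  the pole and \<open>c\<close>. Allowing \<open>c = 0\<close> lets the origin serve as a negative
  place, and \<open>T \<noteq> c\<close> still keeps \<open>T\<close> positive.\<close>

lemma pole_cases:
  assumes j: "j \<noteq> 0" and c: "secular c < 0" "c \<ge> 0" "c \<noteq> pole j"
    and no_pole: "\<And>i. i \<noteq> 0 \<Longrightarrow> i \<noteq> j \<Longrightarrow> pole i \<notin> closed_segment (pole j) c"
  obtains (two) "has_at_least 2 (points {pole j})"
  | (root) T where "T \<in> closed_segment (pole j) c" "T \<noteq> c" "regular T" "secular T = 0"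
      "has_at_least 1 (points {T})"
proof (cases "M $ j = 0 \<and> secular (pole j) < 0")
  case True
  then show ?thesis using two points_of_negative_pole j pole_pos by blast
next
  case False
  obtain T where T: "T \<in> closed_segment (pole j) c" "T \<noteq> c" "regular T" "secular T = 0"
  proof (rule root_towards_pole[OF j c(1)])
    show "regular x" if "x \<in> closed_segment (pole j) c" "x \<noteq> pole j" for x
      using that no_pole by (intro regular_if_not_pole) blast
    show "regular (pole j)" if "M $ j = 0" using that regular_pole j by blast
    show "secular (pole j) \<ge> 0" if "M $ j = 0" using that False by simp
  qed (use c in auto)
  moreover from T have "T > 0"
    using pole_pos[OF j] c by (auto simp: closed_segment_eq_real_ivl split: if_splits)
  ultimately show ?thesis using root point_of_root by blast
qed

text \<open>Taking the pole closest to \<open>c\<close> keeps the segment between them free of other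
  poles, as \<open>pole_cases\<close> requires.\<close>

lemma nearest_pole_below:
  assumes "i \<noteq> 0" "a < pole i" "pole i < c"
  obtains j where "j \<noteq> 0" "a < pole j" "pole j < c"
    "\<And>k. k \<noteq> 0 \<Longrightarrow> pole k < c \<Longrightarrow> pole k \<le> pole j"
proof -
  let ?J = "{k. k \<noteq> 0 \<and> pole k < c}"
  have "finite (pole ` ?J)" "pole ` ?J \<noteq> {}" using assms by auto
  then obtain j where "j \<in> ?J" "Max (pole ` ?J) = pole j"
    using Max_in[of "pole ` ?J"] by blast
  moreover from this have "\<forall>k\<in>?J. pole k \<le> pole j"
    using \<open>finite _\<close> by (metis (no_types, lifting) Max_ge image_eqI)
  ultimately show ?thesis using that[of j] assms by force
qed

lemma nearest_pole_above:
  assumes "i \<noteq> 0" "a < pole i" "pole i < c"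
  obtains j where "j \<noteq> 0" "a < pole j" "pole j < c"
    "\<And>k. k \<noteq> 0 \<Longrightarrow> a < pole k \<Longrightarrow> pole j \<le> pole k"
proof -
  let ?J = "{k. k \<noteq> 0 \<and> a < pole k}"
  have "finite (pole ` ?J)" "pole ` ?J \<noteq> {}" using assms by auto
  then obtain j where "j \<in> ?J" "Min (pole ` ?J) = pole j"
    using Min_in[of "pole ` ?J"] by blast
  moreover from this have "\<forall>k\<in>?J. pole j \<le> pole k"
    using \<open>finite _\<close> by (metis (no_types, lifting) Min_le image_eqI)
  ultimately show ?thesis using that[of j] assms by force
qed

lemma one_point_below:
  assumes c: "secular c < 0" "\<And>i. i \<noteq> 0 \<Longrightarrow> pole i \<noteq> c" and i: "i \<noteq> 0" "pole i < c"
  shows "has_at_least 1 (points {..<c})"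
proof -
  obtain j where j: "j \<noteq> 0" "pole j < c" "\<And>k. k \<noteq> 0 \<Longrightarrow> pole k < c \<Longrightarrow> pole k \<le> pole j"
    using nearest_pole_below[OF i(1) pole_pos i(2)] i by metis
  have "c \<ge> 0" "c \<noteq> pole j" using j pole_pos[of j] by auto
  moreover have "pole k \<notin> closed_segment (pole j) c" if "k \<noteq> 0" "k \<noteq> j" for k
    using j c(2)[OF that(1)] that pole_inj[of k j] by (force simp: closed_segment_eq_real_ivl)
  ultimately show ?thesis
  proof (rule pole_cases[OF j(1) c(1)])
    assume "has_at_least 2 (points {pole j})"
    then have "has_at_least 1 (points {pole j})"
      unfolding has_at_least_def by (metis card_2_iff finite.emptyI finite_insert
          One_nat_def card_1_singleton_iff insert_subset empty_subsetI)
    then show ?thesis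
      by (rule has_at_least_points_mono) (use j in auto)
  next
    fix T assume T: "T \<in> closed_segment (pole j) c" "T \<noteq> c" "has_at_least 1 (points {T})"
    then have "T < c" using j by (auto simp: closed_segment_eq_real_ivl split: if_splits)
    then show ?thesis by (intro has_at_least_points_mono[OF T(3)]) auto
  qed
qed

text \<open>Each term is either identically 0 or has its pole outside the interval and is convex
  there, so \<open>secular\<close> lies below its chord.\<close>

lemma secular_convex:
  assumes "a \<le> c" and reg: "\<And>x. x \<in> {a..c} \<Longrightarrow> regular x" and x: "x \<in> {a..c}"
    and neg: "secular a < 0" "secular c < 0"
  shows "secular x < 0"
proof -
  obtain u where u: "0 \<le> u" "u \<le> 1" "x = (1 - u) * a + u * c"
    using x \<open>a \<le> c\<close> closed_segment_eq_real_ivl[of a c] unfolding in_segment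
    by (metis (mono_tags, lifting) in_segment(1) real_scaleR_def)
  have "(M $ i / (M $ 0 - gap i * x))\<^sup>2
      \<le> (1 - u) * (M $ i / (M $ 0 - gap i * a))\<^sup>2 + u * (M $ i / (M $ 0 - gap i * c))\<^sup>2"
    if "i \<in> -{0}" for i
  proof (cases "M $ i = 0")
    case False
    have i: "i \<noteq> 0" using that by simp
    have no: "pole i \<notin> {a..c}"
      using reg[of "pole i"] False i pole_iff[OF i, of "pole i"] by (auto simp: regular_def)
    have eq: "M $ 0 - gap i * T = gap i * (pole i - T)" for T
      using gap_pos[OF i] by (simp add: pole_def field_simps)
    \<comment> \<open>Both endpoints lie on the same side of the pole.\<close>
    have "(pole i - a) * (pole i - c) > 0"
      using no \<open>a \<le> c\<close> by (auto simp: zero_less_mult_iff)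
    then have "(M $ 0 - gap i * a) * (M $ 0 - gap i * c) > 0"
      using gap_pos[OF i] unfolding eq by (metis mult.assoc mult.left_commute mult_pos_pos)
    from inverse_square_convex[OF this u(1,2)]
    have "(1 / (M $ 0 - gap i * x))\<^sup>2
      \<le> (1 - u) * (1 / (M $ 0 - gap i * a))\<^sup>2 + u * (1 / (M $ 0 - gap i * c))\<^sup>2"
      by (simp add: u(3) algebra_simps)
    from mult_left_mono[OF this, of "(M $ i)\<^sup>2"] show ?thesis
      by (simp add: power_divide algebra_simps)
  qed simp
  then have "secular x + 1 \<le> (\<Sum>i\<in>-{0}. (1 - u) * (M $ i / (M $ 0 - gap i * a))\<^sup>2
        + u * (M $ i / (M $ 0 - gap i * c))\<^sup>2)"
    unfolding secular_def by (auto intro!: sum_mono)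
  also have "\<dots> = (1 - u) * secular a + u * secular c + 1"
    unfolding secular_def sum.distrib sum_distrib_left[symmetric] by (simp add: algebra_simps)
  also have "\<dots> < 1"
  proof (cases "u = 0")
    case False
    then have "u * secular c < 0" using u neg by (simp add: mult_pos_neg)
    moreover have "(1 - u) * secular a \<le> 0" using u neg by (simp add: mult_nonneg_nonpos)
    ultimately show ?thesis by simp
  qed (use neg in simp)
  finally show ?thesis by simp
qed

text \<open>One root is sought between \<open>a\<close> and the first pole above it, the other
  between the last pole below \<open>c\<close> and \<open>c\<close>. Either a single pole already
  gives two points, or \<open>T \<le> pole j \<le> pole l \<le> T'\<close>, and only a coincidence
  at a common pole has to be excluded.\<close>

lemma two_points_between:
  assumes a: "a \<ge> 0" "secular a < 0" "\<And>i. i \<noteq> 0 \<Longrightarrow> pole i \<noteq> a"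
    and c: "secular c < 0" "\<And>i. i \<noteq> 0 \<Longrightarrow> pole i \<noteq> c"
    and i: "i \<noteq> 0" "a < pole i" "pole i < c"
  shows "has_at_least 2 (points {a<..<c})"
proof -
  obtain j where j: "j \<noteq> 0" "a < pole j" "pole j < c"
    "\<And>k. k \<noteq> 0 \<Longrightarrow> a < pole k \<Longrightarrow> pole j \<le> pole k"
    using nearest_pole_above[OF i] by metis
  obtain l where l: "l \<noteq> 0" "a < pole l" "pole l < c"
    "\<And>k. k \<noteq> 0 \<Longrightarrow> pole k < c \<Longrightarrow> pole k \<le> pole l"
    using nearest_pole_below[OF i] by metis
  have inside: "has_at_least 2 (points {a<..<c})"
    if "has_at_least 2 (points {pole k})" "a < pole k" "pole k < c" for k
    by (rule has_at_least_points_mono[OF that(1)]) (use that in auto)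
  have sep: "pole k \<notin> closed_segment (pole j) a" if "k \<noteq> 0" "k \<noteq> j" for k
    using j(2) j(4)[OF that(1)] a(3)[OF that(1)] that pole_inj[of k j] j(1)
    by (force simp: closed_segment_eq_real_ivl)
  have sep': "pole k \<notin> closed_segment (pole l) c" if "k \<noteq> 0" "k \<noteq> l" for k
    using l(3) l(4)[OF that(1)] c(2)[OF that(1)] that pole_inj[of k l] l(1)
    by (force simp: closed_segment_eq_real_ivl)
  have "a \<noteq> pole j" "c \<ge> 0" "c \<noteq> pole l" using j l a by auto
  consider (two) "has_at_least 2 (points {pole j}) \<or> has_at_least 2 (points {pole l})"
    | (roots) T T' where "T \<in> closed_segment (pole j) a" "T \<noteq> a" "regular T" "secular T = 0"
      "has_at_least 1 (points {T})" "T' \<in> closed_segment (pole l) c" "T' \<noteq> c"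
      "has_at_least 1 (points {T'})"
  proof (rule pole_cases[OF j(1) a(2,1) \<open>a \<noteq> pole j\<close> sep])
    fix T assume T: "T \<in> closed_segment (pole j) a" "T \<noteq> a" "regular T" "secular T = 0"
      "has_at_least 1 (points {T})"
    show ?thesis
      by (rule pole_cases[OF l(1) c(1) \<open>c \<ge> 0\<close> \<open>c \<noteq> pole l\<close> sep'])
         (use that T in blast)+
  qed (use that in blast)+
  then show ?thesis
  proof cases
    case two
    then show ?thesis using inside j l by blast
  next
    case roots
    have T: "a < T" "T \<le> pole j" "pole l \<le> T'" "T' < c"
      using roots j l by (auto simp: closed_segment_eq_real_ivl split: if_splits)
    have "pole j \<le> pole l" using j l by blast
    have "T \<noteq> T'"
    proof
      assume "T = T'"
      then have T_eq: "T = pole j" and "pole j = pole l"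
        using T \<open>pole j \<le> pole l\<close> by auto
      then have "j = l" using pole_inj j l by blast
      \<comment> \<open>The only pole in between is removable, so \<open>secular\<close> is convex there and cannot vanish.\<close>
      have "M $ j = 0"
        using roots(3) j pole_iff[OF j(1), of "pole j"] by (auto simp: regular_def T_eq)
      have reg: "regular x" if "x \<in> {a..c}" for x
      proof (cases "x = pole j")
        case True
        then show ?thesis using regular_pole j \<open>M $ j = 0\<close> by simp
      next
        case False
        show ?thesis
        proof (rule regular_if_not_pole)
          fix k :: 4 assume k: "k \<noteq> 0"
          show "pole k \<noteq> x"
            using k j(4)[OF k] l(4)[OF k] a(3)[OF k] c(2)[OF k] that False \<open>j = l\<close> by force
        qed
      qed
      have "secular T < 0"
        unfolding T_eq
      proof (rule secular_convex)
        show "a \<le> c" "pole j \<in> {a..c}" using j(2,3) by auto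
      qed (fact reg a(2) c(1))+
      then show False using roots by simp
    qed
    then show ?thesis
      by (intro has_at_least_points_Un[OF roots(5,8)]) (use T \<open>pole j \<le> pole l\<close> j l in auto)
  qed
qed

section \<open>Caustic cones as negative values between consecutive poles\<close>

lemma caustic_cone_negative:
  assumes int: "M \<in> interior (caustic_cone \<Lambda> i)" and i: "i = 1 \<or> i = 2"
  obtains T where "pole i < T" "T < pole (i + 1)" "secular T < 0"
proof -
  \<comment> \<open>Stretching the spatial part of \<open>M\<close> by \<open>1 + \<delta>\<close> stays inside the cone and shrinks the secular
    function of \<open>M\<close> strictly below the one of the stretched vector, which is at most \<open>0\<close>.\<close>
  obtain e where e: "e > 0" "ball M e \<subseteq> caustic_cone \<Lambda> i"
    using int by (metis mem_interior)
  define S :: "real^4" where "S = (\<chi> k. if k = 0 then 0 else M $ k)"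
  \<comment> \<open>Small enough for the stretched vector to stay in the ball; the summand 1 covers
    \<open>S = 0\<close>.\<close>
  define \<delta> where "\<delta> = e / (1 + norm S)"
  have \<delta>: "\<delta> > 0" using e by (auto simp: \<delta>_def add_pos_nonneg)
  have "\<delta> * norm S < e" using e by (simp add: \<delta>_def field_simps add_pos_nonneg)
  then have "M + \<delta> *\<^sub>R S \<in> ball M e" using \<delta> by (simp add: dist_norm)
  then have "M + \<delta> *\<^sub>R S \<in> caustic_cone \<Lambda> i" using e by blast
  then obtain s n where s: "s > 0" "(M + \<delta> *\<^sub>R S) $ 0 > 0" "(M + \<delta> *\<^sub>R S) $ 0 \<le> gap i * s" "gap (i + 1) * s \<le> (M + \<delta> *\<^sub>R S) $ 0"
    and n: "\<And>k. k \<noteq> 0 \<Longrightarrow> (M + \<delta> *\<^sub>R S) $ k = ((M + \<delta> *\<^sub>R S) $ 0 - gap k * s) * n k"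
    and norm: "(\<Sum>k\<in>-{0}. (n k)\<^sup>2) = 1"
    using i by (rule caustic_coneE) blast
  have nz: "i \<noteq> 0" "i + 1 \<noteq> 0" using i by auto
  have bounds: "pole i \<le> s" "s \<le> pole (i + 1)"
    using s gap_pos[OF nz(1)] gap_pos[OF nz(2)] by (simp_all add: pole_def S_def field_simps)
  have M_eq: "(1 + \<delta>) * M $ k = (M $ 0 - gap k * s) * n k" if "k \<noteq> 0" for k
    using n[OF that] that by (simp add: S_def algebra_simps)
  have reg: "regular s"
    unfolding regular_def using M_eq \<delta> by (metis add_pos_pos diff_self less_irrefl mult_eq_0_iff zero_less_one)
  \<comment> \<open>The terms agree except where a denominator vanishes, and there the left one is 0
    by the convention for division.\<close>
  have "secular s \<le> (\<Sum>k\<in>-{0}. (n k / (1 + \<delta>))\<^sup>2) - 1"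
  proof -
    have "(M $ k / (M $ 0 - gap k * s))\<^sup>2 \<le> (n k / (1 + \<delta>))\<^sup>2" if "k \<in> -{0}" for k
    proof (cases "M $ 0 = gap k * s")
      case False
      have "M $ k / (M $ 0 - gap k * s) = n k / (1 + \<delta>)"
        using M_eq[of k] that False \<delta> by (simp add: field_simps)
      then show ?thesis by simp
    qed simp
    then show ?thesis unfolding secular_def by (auto intro!: sum_mono)
  qed
  also have "\<dots> = 1 / (1 + \<delta>)\<^sup>2 - 1"
    by (simp add: power_divide sum_divide_distrib[symmetric] norm)
  also have "\<dots> < 0" using \<delta> by (simp add: one_less_power)
  finally have "\<forall>\<^sub>F T in at s. secular T < 0"
    using isCont_secular[OF reg] by (simp add: isCont_def order_tendstoD(2))
  then obtain d where d: "d > 0" "\<And>T. T \<noteq> s \<Longrightarrow> \<bar>T - s\<bar> < d \<Longrightarrow> secular T < 0"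
    unfolding eventually_at by (auto simp: dist_real_def)
  \<comment> \<open>The value \<open>s\<close> may itself be one of the two poles, so continuity is
    used to move to a nearby point strictly between them.\<close>
  have less: "pole i < pole (i + 1)" using i pole_less by auto
  show ?thesis
  proof (cases "s < pole (i + 1)")
    case True
    obtain T where "s < T" "T < min (pole (i + 1)) (s + d)"
      using dense[of s "min (pole (i + 1)) (s + d)"] True d by auto
    then show ?thesis using bounds d(2)[of T] by (intro that[of T]) auto
  next
    case False
    obtain T where "max (pole i) (s - d) < T" "T < s"
      using dense[of "max (pole i) (s - d)" s] False less d by auto
    then show ?thesis using bounds d(2)[of T] by (intro that[of T]) auto
  qed
qed

section \<open>Adding up the points\<close>

text \<open>The places where \<open>secular\<close> is negative cut the axis into disjoint ranges,
  each containing a pole: \<open>c\<close> beyond the last pole, \<open>T\<close> and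
  \<open>U\<close> from the caustic cones, and 0 for \<open>M\<close> inside the future cone. The
  lowest range gives one point, or two when 0 bounds it from below; every other range gives
  two.\<close>

lemma point_counts:
  shows "has_at_least 1 (points UNIV)"
    and "M \<in> interior LC_plus \<Longrightarrow> has_at_least 2 (points UNIV)"
    and "i = 1 \<or> i = 2 \<Longrightarrow> M \<in> interior (caustic_cone \<Lambda> i) \<Longrightarrow> has_at_least 3 (points UNIV)"
    and "i = 1 \<or> i = 2 \<Longrightarrow> M \<in> interior (caustic_cone \<Lambda> i) \<Longrightarrow> M \<in> interior LC_plus \<Longrightarrow>
           has_at_least 4 (points UNIV)"
    and "M \<in> interior (caustic_cone \<Lambda> 1) \<Longrightarrow> M \<in> interior (caustic_cone \<Lambda> 2) \<Longrightarrow>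
           has_at_least 5 (points UNIV)"
    and "M \<in> interior (caustic_cone \<Lambda> 1) \<Longrightarrow> M \<in> interior (caustic_cone \<Lambda> 2) \<Longrightarrow>
           M \<in> interior LC_plus \<Longrightarrow> has_at_least 6 (points UNIV)"
proof -
  obtain c where c: "c > pole 3" "secular c < 0"
    using secular_eventually_negative by metis
  have ne: "pole k \<noteq> T" if "k \<noteq> 0" "pole 1 < T" "pole 2 \<noteq> T" "pole 3 \<noteq> T" for k T
    using nonzero_index_cases[OF that(1)] that by auto
  have c_ne: "pole k \<noteq> c" if "k \<noteq> 0" for k
    using ne[OF that, of c] c pole_less by auto
  have zero: "secular 0 < 0" if "M \<in> interior LC_plus"
  proof -
    have "(\<Sum>i\<in>-{0}. (M $ i)\<^sup>2) < (M $ 0)\<^sup>2"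
      using interior_LC_plus_future[OF that] by (simp add: minkowski_split)
    moreover have "secular 0 = (\<Sum>i\<in>-{0}. (M $ i)\<^sup>2) / (M $ 0)\<^sup>2 - 1"
      by (simp add: secular_def power_divide sum_divide_distrib)
    ultimately show ?thesis using M0_pos by simp
  qed
  have zero_ne: "pole k \<noteq> 0" if "k \<noteq> 0" for k using pole_pos[OF that] by simp
  have all: "has_at_least n (points A) \<Longrightarrow> has_at_least n (points UNIV)" for n A
    by (rule has_at_least_points_mono) auto
  show "has_at_least 1 (points UNIV)"
    using one_point_below[OF c(2) c_ne, of 3] c by (intro all) auto
  show "has_at_least 2 (points UNIV)" if "M \<in> interior LC_plus"
    using two_points_between[OF _ zero[OF that] zero_ne c(2) c_ne, of 3] c pole_pos[of 3]
    by (intro all) auto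
  have caustic: "\<exists>T>0. pole i < T \<and> secular T < 0 \<and> (\<forall>k. k \<noteq> 0 \<longrightarrow> pole k \<noteq> T) \<and> T < pole (i + 1)"
    if i: "i = 1 \<or> i = 2" and int: "M \<in> interior (caustic_cone \<Lambda> i)" for i
  proof -
    obtain T where T: "pole i < T" "T < pole (i + 1)" "secular T < 0"
      using caustic_cone_negative[OF int i] .
    moreover have "T > 0" using pole_pos[of i] i T by auto
    moreover have "pole k \<noteq> T" if "k \<noteq> 0" for k
      using nonzero_index_cases[OF that] T i pole_less by auto
    ultimately show ?thesis by blast
  qed
  {
    fix i assume i: "i = 1 \<or> i = 2" and "M \<in> interior (caustic_cone \<Lambda> i)"
    then obtain T where T: "T > 0" "pole i < T" "secular T < 0" "\<And>k. k \<noteq> 0 \<Longrightarrow> pole k \<noteq> T"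
      "T < pole (i + 1)" using caustic by metis
    have nz: "i \<noteq> 0" "i + 1 \<noteq> 0" using i by auto
    have "pole (i + 1) < c" using i c pole_less by auto
    then have above: "has_at_least 2 (points {T<..<c})"
      using T nz by (intro two_points_between[OF _ _ _ c(2) c_ne nz(2)]) auto
    have "has_at_least 1 (points {..<T})"
      using T nz by (intro one_point_below[of T i]) auto
    then show "has_at_least 3 (points UNIV)"
      by (rule has_at_least_points_Un[OF _ above]) auto
    assume "M \<in> interior LC_plus"
    then have "has_at_least 2 (points {0<..<T})"
      using T nz pole_pos[of i] zero zero_ne by (intro two_points_between[of 0 T i]) auto
    then show "has_at_least 4 (points UNIV)"
      by (rule has_at_least_points_Un[OF _ above]) auto
  }
  assume "M \<in> interior (caustic_cone \<Lambda> 1)" "M \<in> interior (caustic_cone \<Lambda> 2)"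
  then obtain T U where T: "T > 0" "pole 1 < T" "secular T < 0" "\<And>k. k \<noteq> 0 \<Longrightarrow> pole k \<noteq> T" "T < pole 2"
    and U: "U > 0" "pole 2 < U" "secular U < 0" "\<And>k. k \<noteq> 0 \<Longrightarrow> pole k \<noteq> U" "U < pole 3"
    using caustic[of 1] caustic[of 2] by auto
  have above: "has_at_least 2 (points {U<..<c})"
    using U c by (intro two_points_between[OF _ _ _ c(2) c_ne, of U 3]) auto
  have "has_at_least 2 (points {T<..<U})"
    using T U by (intro two_points_between[of T U 2]) auto
  then have four: "has_at_least 4 (points {T<..<c})"
    by (rule has_at_least_points_Un[OF _ above]) (use T U c in auto)
  have "has_at_least 1 (points {..<T})"
    using T by (intro one_point_below[of T 1]) auto
  then show "has_at_least 5 (points UNIV)"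
    by (rule has_at_least_points_Un[OF _ four]) auto
  assume "M \<in> interior LC_plus"
  then have "has_at_least 2 (points {0<..<T})"
    using T pole_pos[of 1] zero zero_ne by (intro two_points_between[of 0 T 1]) auto
  then show "has_at_least 6 (points UNIV)"
    by (rule has_at_least_points_Un[OF _ four]) auto
qed

end

theorem proposition7:
  fixes M :: "real^4" and L :: "real^4^4" and \<Lambda> :: "real^4"
  assumes "positivity_constraint L"
    and "L = prototype_tensor \<Lambda>"
    and "\<Lambda> $ 0 > 0"
    and "\<Lambda> $ 0 > \<Lambda> $ 3" and "\<Lambda> $ 3 > \<Lambda> $ 2" and "\<Lambda> $ 2 > \<Lambda> $ 1"
  shows "(M \<notin> LC_minus \<longrightarrow> has_at_least 1 (neutral_stationary_points M L)) \<and>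
    (M \<in> interior LC_plus \<longrightarrow> has_at_least 2 (neutral_stationary_points M L)) \<and>
    (M \<in> interior (caustic_cone \<Lambda> 1) \<or> M \<in> interior (caustic_cone \<Lambda> 2) \<longrightarrow>
       (M \<notin> LC_minus \<longrightarrow> has_at_least 3 (neutral_stationary_points M L)) \<and>
       (M \<in> interior LC_plus \<longrightarrow> has_at_least 4 (neutral_stationary_points M L))) \<and>
    (M \<in> interior (caustic_cone \<Lambda> 1) \<and> M \<in> interior (caustic_cone \<Lambda> 2) \<longrightarrow>
       (M \<notin> LC_minus \<longrightarrow> has_at_least 5 (neutral_stationary_points M L)) \<and>
       (M \<in> interior LC_plus \<longrightarrow> has_at_least 6 (neutral_stationary_points M L)))"
proof -
  interpret prototypical_model M \<Lambda>
    using assms by unfold_locales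
  have nsp: "neutral_stationary_points M L = points UNIV"
    by (simp add: points_def assms(2))
  show ?thesis
  \<comment> \<open>Each of the three interiors forces \<open>M $ 0 > 0\<close>, so for
    \<open>M $ 0 \<le> 0\<close> only the first claim has content.\<close>
  proof (cases "M $ 0 > 0")
    case True
    then interpret future_model M \<Lambda> by unfold_locales
    show ?thesis unfolding nsp using point_counts by blast
  next
    case False
    then have "M \<notin> interior LC_plus" "M \<notin> interior (caustic_cone \<Lambda> 1)"
      "M \<notin> interior (caustic_cone \<Lambda> 2)"
      using interior_LC_plus_future caustic_cone_future by blast+
    then show ?thesis unfolding nsp using False point_of_nonfuture by simp
  qed
qed

end
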